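(* Let $\langle P,T,\mathbf{Pre},\mathbf{Post}\rangle$ be a state-machine Petri net with incidence matrix $\mathbf{C}=\mathbf{Post}-\mathbf{Pre}$, let $\mathbf{m}_0\in\mathbb{N}_{\ge 0}^{|P|}$ be the initial marking and $\mathbf{m}_f$ the final (goal) marking of a TAPF instance, and fix an integer value $s\ge 1$. Then the $2|P|\times|T|$ matrix $$\begin{bmatrix}\mathbf{C}\\ \mathbf{Post}\end{bmatrix}$$ is totally unimodular. Consequently, if the linear program in the variable $\boldsymbol{\sigma}\in\mathbb{R}^{|T|}$ $$\begin{aligned}\text{minimize}\quad & \mathbf{1}^\top\boldsymbol{\sigma}+M\,s\\ \text{subject to}\quad & \mathbf{C}\,\boldsymbol{\sigma}=\mathbf{m}_f-\mathbf{m}_0,\\ & \mathbf{Post}\,\boldsymbol{\sigma}+\mathbf{m}_0\le s\,\mathbf{1},\\ & \boldsymbol{\sigma}\ge \mathbf{0}\end{aligned}$$ (with $s$ fixed, and $M>0$ a constant) is feasible, then it admits an optimal solution $\boldsymbol{\sigma}$ all of whose entries are integers.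
   Context: A Petri net here consists of a finite set $P$ of places, a finite set $T$ of transitions, and matrices $\mathbf{Pre},\mathbf{Post}\in\{0,1\}^{|P|\times|T|}$. It is a state machine if every transition $t$ has exactly one input place and exactly one output place, i.e. each column of $\mathbf{Pre}$ and each column of $\mathbf{Post}$ has exactly one entry equal to $1$ (all others $0$). The incidence matrix is $\mathbf{C}=\mathbf{Post}-\mathbf{Pre}$. A marking is a vector in $\mathbb{N}_{\ge 0}^{|P|}$ (number of robots/tokens in each place); $\boldsymbol{\sigma}$ is a firing-count vector. TAPF (task assignment and path finding) instance: the initial marking $\mathbf{m}_0$ contains $n_R$ tokens in total, there are $n_R$ regions of interest, each corresponding to exactly one place and distinct regions to distinct places, and every region must be occupied by exactly one robot at the end; thus $\mathbf{m}_f=\mathbf{V}^\top\mathbf{1}\in\{0,1\}^{|P|}$ is the indicator vector of the $n_R$ goal places, where $\mathbf{V}$ is the $0/1$ region-by-place matrix with exactly one $1$ in each row. A matrix is totally unimodular if each of its square submatrices has determinant in $\{-1,0,1\}$. Inequalities between vectors are entrywise, and $\mathbf{1}$ is the all-ones vector. *)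

theory Defs
  imports "Jordan_Normal_Form.Determinant" "Jordan_Normal_Form.DL_Submatrix"
begin

text \<open>Places and transitions are numbered, so that \<open>P = {..<nP}\<close> and \<open>T = {..<nT}\<close>.
  Sums, products and the order on matrices and vectors are those of Jordan_Normal_Form;
  in particular \<open>v \<le> w\<close> on vectors is entrywise.\<close>

definition zero_one_mat :: "real mat \<Rightarrow> bool" where
  "zero_one_mat A \<longleftrightarrow> (\<forall>i<dim_row A. \<forall>j<dim_col A. A $$ (i, j) \<in> {0, 1})"

definition petri_net :: "nat \<Rightarrow> nat \<Rightarrow> real mat \<Rightarrow> real mat \<Rightarrow> bool" where
  "petri_net nP nT Pre Post \<longleftrightarrow>
     Pre \<in> carrier_mat nP nT \<and> Post \<in> carrier_mat nP nT \<and>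
     zero_one_mat Pre \<and> zero_one_mat Post"

definition state_machine :: "nat \<Rightarrow> nat \<Rightarrow> real mat \<Rightarrow> real mat \<Rightarrow> bool" where
  "state_machine nP nT Pre Post \<longleftrightarrow>
     petri_net nP nT Pre Post \<and>
     (\<forall>t<nT. (\<exists>!p. p < nP \<and> Pre $$ (p, t) = 1) \<and> (\<exists>!p. p < nP \<and> Post $$ (p, t) = 1))"

definition incidence_matrix :: "real mat \<Rightarrow> real mat \<Rightarrow> real mat" where
  "incidence_matrix Pre Post = Post - Pre"

definition ones_vec :: "nat \<Rightarrow> real vec" where
  "ones_vec n = vec n (\<lambda>_. 1)"

text \<open>\<open>V\<close> is the region-by-place matrix. Its last condition says that distinct regions
  lie in distinct places.\<close>

definition tapf_instance :: "nat \<Rightarrow> nat \<Rightarrow> nat vec \<Rightarrow> real mat \<Rightarrow> bool" where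
  "tapf_instance nP nR m0 V \<longleftrightarrow>
     m0 \<in> carrier_vec nP \<and> (\<Sum>p<nP. m0 $ p) = nR \<and>
     V \<in> carrier_mat nR nP \<and> zero_one_mat V \<and>
     (\<forall>r<nR. \<exists>!p. p < nP \<and> V $$ (r, p) = 1) \<and>
     (\<forall>r<nR. \<forall>r'<nR. \<forall>p<nP. V $$ (r, p) = 1 \<and> V $$ (r', p) = 1 \<longrightarrow> r = r')"

definition final_marking :: "real mat \<Rightarrow> real vec" where
  "final_marking V = transpose_mat V *\<^sub>v ones_vec (dim_row V)"

definition totally_unimodular :: "real mat \<Rightarrow> bool" where
  "totally_unimodular A \<longleftrightarrow>
     (\<forall>I J. I \<subseteq> {..<dim_row A} \<longrightarrow> J \<subseteq> {..<dim_col A} \<longrightarrow> card I = card J \<longrightarrow>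
        det (submatrix A I J) \<in> {-1, 0, 1})"

definition lp_feasible ::
  "real mat \<Rightarrow> real mat \<Rightarrow> nat vec \<Rightarrow> real vec \<Rightarrow> int \<Rightarrow> real vec \<Rightarrow> bool" where
  "lp_feasible Pre Post m0 mf s \<sigma> \<longleftrightarrow>
     \<sigma> \<in> carrier_vec (dim_col Post) \<and>
     incidence_matrix Pre Post *\<^sub>v \<sigma> = mf - map_vec real m0 \<and>
     Post *\<^sub>v \<sigma> + map_vec real m0 \<le> real_of_int s \<cdot>\<^sub>v ones_vec (dim_row Post) \<and>
     0\<^sub>v (dim_col Post) \<le> \<sigma>"

definition lp_objective :: "real \<Rightarrow> int \<Rightarrow> real vec \<Rightarrow> real" where
  "lp_objective M s \<sigma> = ones_vec (dim_vec \<sigma>) \<bullet> \<sigma> + M * real_of_int s"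

definition lp_optimal ::
  "real mat \<Rightarrow> real mat \<Rightarrow> nat vec \<Rightarrow> real vec \<Rightarrow> real \<Rightarrow> int \<Rightarrow> real vec \<Rightarrow> bool" where
  "lp_optimal Pre Post m0 mf M s \<sigma> \<longleftrightarrow>
     lp_feasible Pre Post m0 mf s \<sigma> \<and>
     (\<forall>\<tau>. lp_feasible Pre Post m0 mf s \<tau> \<longrightarrow> lp_objective M s \<sigma> \<le> lp_objective M s \<tau>)"

end

(* Inside a square submatrix of [C; Post], subtract the row Post_p from C_p whenever both are
   present. This has determinant 1 and leaves at most one +1 and one -1 in each column, i.e. the
   node-arc matrix of a directed graph with some rows deleted, whose determinant is in {-1, 0, 1}.

   For the linear program, split each place into an entry and an exit node joined by an arc of
   capacity s - m0(p); a feasible sigma then is a flow with integral divergences and bounds.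
   Every node touching a fractional arc touches two of them, so the fractional arcs support a
   circulation; pushing along it in a direction that does not increase the cost until some arc
   becomes integral, and repeating, rounds sigma to an integral feasible point of no larger
   cost. Costs of integral feasible points are natural numbers, so one of them is least. *)

theory Submission
  imports Defs
begin

section \<open>Determinants of node-arc matrices\<close>

text \<open>The all-ones vector is a nonzero kernel vector of the transpose. Positivity of
  \<open>n\<close> excludes the empty matrix, whose determinant is 1.\<close>

lemma det_eq_0_if_column_sums_0:
  fixes A :: "'a :: idom mat"
  assumes A: "A \<in> carrier_mat n n" and "n > 0"
    and zero: "\<And>j. j < n \<Longrightarrow> (\<Sum>i<n. A $$ (i, j)) = 0"
  shows "det A = 0"
proof -
  let ?u = "vec n (\<lambda>_. 1 :: 'a)"
  have "transpose_mat A *\<^sub>v ?u = 0\<^sub>v n"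
  proof (rule eq_vecI)
    fix j assume "j < dim_vec (0\<^sub>v n :: 'a vec)"
    then have j: "j < n" by simp
    have "(transpose_mat A *\<^sub>v ?u) $ j = (\<Sum>i<n. A $$ (i, j))"
      using A j by (simp add: scalar_prod_def lessThan_atLeast0)
    then show "(transpose_mat A *\<^sub>v ?u) $ j = 0\<^sub>v n $ j"
      using zero[OF j] j by simp
  qed (use A in simp)
  moreover have "?u \<noteq> 0\<^sub>v n"
    using \<open>n > 0\<close> by (metis index_vec index_zero_vec(1) zero_neq_one)
  ultimately have "det (transpose_mat A) = 0"
    using A by (subst det_0_iff_vec_prod_zero[of _ n]) (auto intro!: exI[of _ ?u])
  then show ?thesis
    using A by (simp add: det_transpose)
qed

text \<open>The labels \<open>h j\<close> and \<open>a j\<close> need not label any row, which makes the class of these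
  matrices closed under deleting rows.\<close>
lemma det_arc_matrix:
  fixes r h a :: "nat \<Rightarrow> 'a"
  assumes "inj_on r {..<n}"
  shows "det (mat n n (\<lambda>(i, j). of_bool (r i = h j) - of_bool (r i = a j))) \<in> {-1, 0, 1 :: real}"
  using assms
proof (induction n arbitrary: r h a)
  case 0
  show ?case by (simp add: det_dim_zero)
next
  case (Suc n)
  define A where
    "A = mat (Suc n) (Suc n) (\<lambda>(i, j). of_bool (r i = h j) - of_bool (r i = a j) :: real)"
  have A: "A \<in> carrier_mat (Suc n) (Suc n)"
    by (simp add: A_def)
  have entry: "A $$ (i, j) = of_bool (r i = h j) - of_bool (r i = a j)"
    if "i < Suc n" "j < Suc n" for i j
    using that by (simp add: A_def)
  show ?case
  proof (cases "\<forall>j<Suc n. (\<Sum>i<Suc n. A $$ (i, j)) = 0")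
    case True
    then have "det A = 0"
      by (intro det_eq_0_if_column_sums_0[OF A]) auto
    then show ?thesis by (simp add: A_def)
  next
    case False
    then obtain j where j: "j < Suc n" and nz: "(\<Sum>i<Suc n. A $$ (i, j)) \<noteq> 0"
      by blast
    \<comment> \<open>By injectivity of \<open>r\<close>, a label occurs in exactly one row or in
      none.\<close>
    have count: "(\<Sum>i<Suc n. of_bool (r i = x)) = (of_bool (x \<in> r ` {..<Suc n}) :: real)" for x
    proof (cases "x \<in> r ` {..<Suc n}")
      case True
      then obtain i where i: "i < Suc n" "x = r i" by auto
      have "(\<Sum>k<Suc n. of_bool (r k = x)) = (\<Sum>k<Suc n. if k = i then 1 else 0 :: real)"
        using i Suc.prems by (intro sum.cong) (auto simp: inj_on_eq_iff)
      then show ?thesis using i True by (simp del: sum.lessThan_Suc)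
    next
      case False
      then have "(\<Sum>k<Suc n. of_bool (r k = x)) = (\<Sum>k<Suc n. 0 :: real)"
        by (intro sum.cong) auto
      then show ?thesis using False by simp
    qed
    \<comment> \<open>So a column with nonzero sum has exactly one of its two end labels among the
      rows. It then has a single nonzero entry, 1 or -1, and Laplace expansion along it leaves one
      minor.\<close>
    have "(\<Sum>i<Suc n. A $$ (i, j))
        = (\<Sum>i<Suc n. of_bool (r i = h j)) - (\<Sum>i<Suc n. of_bool (r i = a j))"
      using j unfolding sum_subtractf[symmetric] by (intro sum.cong refl entry) auto
    with nz have "h j \<in> r ` {..<Suc n} \<longleftrightarrow> a j \<notin> r ` {..<Suc n}"
      unfolding count by (auto simp del: lessThan_Suc split: if_splits)
    then obtain i where i: "i < Suc n" and i_only: "\<And>k. k < Suc n \<Longrightarrow> k \<noteq> i \<Longrightarrow> A $$ (k, j) = 0"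
      and i_val: "A $$ (i, j) \<in> {-1, 1}"
    proof (cases "h j \<in> r ` {..<Suc n}")
      case True
      then obtain i where "i < Suc n" "r i = h j" by auto
      moreover have "r k \<noteq> a j" if "k < Suc n" for k
        using True that \<open>h j \<in> _ \<longleftrightarrow> _\<close> by (metis imageI lessThan_iff)
      moreover have "r k \<noteq> h j" if "k < Suc n" "k \<noteq> i" for k
        using that \<open>i < Suc n\<close> \<open>r i = h j\<close> Suc.prems by (auto simp: inj_on_def)
      ultimately show ?thesis
        by (intro that[of i]) (auto simp: entry j)
    next
      case False
      then obtain i where "i < Suc n" "r i = a j"
        using \<open>h j \<in> _ \<longleftrightarrow> _\<close> by (auto simp del: lessThan_Suc)
      moreover have "r k \<noteq> a j" if "k < Suc n" "k \<noteq> i" for k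
        using that \<open>i < Suc n\<close> \<open>r i = a j\<close> Suc.prems by (auto simp: inj_on_def)
      moreover have "r k \<noteq> h j" if "k < Suc n" for k
        using False that by (metis imageI lessThan_iff)
      ultimately show ?thesis
        by (intro that[of i]) (auto simp: entry j)
    qed
    \<comment> \<open>\<open>sk m\<close> enumerates the indices other than \<open>m\<close>.
      Composing the labels with it shows that the minor is again an arc matrix with injective row
      labels.\<close>
    define sk where "sk m k = (if k < m then k else Suc k)" for m k :: nat
    have "inj_on (r \<circ> sk i) {..<n}"
    proof (rule comp_inj_on)
      show "inj_on (sk i) {..<n}" by (auto simp: inj_on_def sk_def split: if_splits)
      show "inj_on r (sk i ` {..<n})"
        using Suc.prems by (rule inj_on_subset) (auto simp: sk_def)
    qed
    note minor = Suc.IH[OF this, of "h \<circ> sk j" "a \<circ> sk j"]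
    have "mat_delete A i j = mat n n (\<lambda>(k, l).
        of_bool ((r \<circ> sk i) k = (h \<circ> sk j) l) - of_bool ((r \<circ> sk i) k = (a \<circ> sk j) l))"
      by (rule eq_matI) (auto simp: A_def mat_delete_def sk_def)
    with minor have "det (mat_delete A i j) \<in> {-1, 0, 1}"
      by simp
    moreover have "det A = A $$ (i, j) * cofactor A i j"
      unfolding laplace_expansion_column[OF A j] using i i_only
      by (subst sum.remove[of _ i]) (auto simp: algebra_simps intro!: sum.neutral)
    moreover have "(-1 :: real) ^ (i + j) \<in> {-1, 1}"
      by (cases "even (i + j)") auto
    ultimately have "det A \<in> {-1, 0, 1}"
      using i_val by (auto simp: cofactor_def)
    then show ?thesis by (simp add: A_def)
  qed
qed

section \<open>Total unimodularity of the stacked matrix\<close>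

text \<open>The row operations are collected in one unitriangular matrix \<open>L\<close>.
  Multiplying a square submatrix by \<open>L\<close> from the left keeps the determinant and yields
  a matrix to which \<open>det_arc_matrix\<close> applies.\<close>

lemma totally_unimodular_incidence_append_post:
  fixes pre post :: "nat \<Rightarrow> nat"
  assumes Pre: "Pre = mat nP nT (\<lambda>(p, t). of_bool (p = pre t))"
    and Post: "Post = mat nP nT (\<lambda>(p, t). of_bool (p = post t))"
    and pre: "\<And>t. t < nT \<Longrightarrow> pre t < nP" and post: "\<And>t. t < nT \<Longrightarrow> post t < nP"
  shows "totally_unimodular (incidence_matrix Pre Post @\<^sub>r Post)"
  unfolding totally_unimodular_def
proof (intro allI impI)
  fix I J
  define A where "A = incidence_matrix Pre Post @\<^sub>r Post"
  have dim: "dim_row A = nP + nP" "dim_col A = nT"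
    by (simp_all add: A_def append_rows_def incidence_matrix_def Pre Post)
  assume IJ: "I \<subseteq> {..<dim_row A}" "J \<subseteq> {..<dim_col A}" "card I = card J"
  define k where "k = card I"
  define r where "r = pick I"
  define c where "c = pick J"
  have entry: "A $$ (i, t) = (if i < nP then of_bool (i = post t) - of_bool (i = pre t)
      else of_bool (i = nP + post t))" if "i < nP + nP" "t < nT" for i t
    using that by (auto simp: A_def append_rows_def incidence_matrix_def Pre Post)
  have fin: "finite I"
    using IJ(1) finite_subset by blast
  have rI: "r i \<in> I" if "i < k" for i
    using that pick_in_set_le unfolding r_def k_def by blast
  have r_less: "r i < nP + nP" if "i < k" for i
    using rI[OF that] IJ(1) dim by auto
  have c_less: "c j < nT" if "j < k" for j
    using that pick_in_set_le[of j J] IJ(2,3) dim unfolding c_def k_def by auto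
  have r_mono: "r i < r i'" if "i < i'" "i' < k" for i i'
    using that pick_mono_le unfolding r_def k_def by blast
  have inj: "inj_on r {..<k}"
    by (intro linorder_inj_onI') (use r_mono in fastforce)
  have surj: "\<exists>i<k. r i = x" if "x \<in> I" for x
  proof -
    have "r ` {..<k} = I"
      using rI fin inj by (intro card_subset_eq) (auto simp: card_image k_def)
    then show ?thesis using that by auto
  qed
  define B where "B = submatrix A I J"
  have "{i. i < dim_row A \<and> i \<in> I} = I" "{j. j < dim_col A \<and> j \<in> J} = J"
    using IJ by auto
  then have B: "B = mat k k (\<lambda>(i, j). A $$ (r i, c j))"
    using IJ(3) by (simp add: B_def submatrix_def k_def r_def c_def)
  \<comment> \<open>Row \<open>i\<close> of \<open>L * B\<close> is row \<open>i\<close> of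
    \<open>B\<close>, minus the row of \<open>Post\<close> for the same place if that row is
    selected. Since \<open>r\<close> is increasing and \<open>nP + r i\<close> exceeds
    \<open>r i\<close>, the subtracted row lies further down, so \<open>L\<close> is upper
    triangular with unit diagonal.\<close>
  define L :: "real mat" where
    "L = mat k k (\<lambda>(i, l). of_bool (i = l) - of_bool (r i < nP \<and> r l = nP + r i))"
  have dim_L: "dim_row L = k" and dim_B: "dim_col B = k"
    by (simp_all add: L_def B)
  have "upper_triangular L"
    unfolding upper_triangular_def using r_mono by (fastforce simp: L_def)
  then have "det L = prod_list (diag_mat L)"
    by (rule det_upper_triangular[of _ k]) (simp add: L_def)
  also have "diag_mat L = replicate k 1"
    by (auto simp: diag_mat_def L_def list_eq_iff_nth_eq)
  finally have "det L = 1" by simp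
  \<comment> \<open>If row \<open>nP + post (c j)\<close> is selected, the +1 of column
    \<open>j\<close> survives there only, as the one in the \<open>C\<close> block is cancelled.
    Otherwise it stays at \<open>post (c j)\<close>, provided that row is selected. The -1 at
    \<open>pre (c j)\<close> is never affected.\<close>
  define h where
    "h j = (if nP + post (c j) \<in> I then nP + post (c j) else post (c j))" for j
  have LB: "(L * B) $$ (i, j) = of_bool (r i = h j) - of_bool (r i = pre (c j))"
    if i: "i < k" and j: "j < k" for i j
  proof -
    have "(L * B) $$ (i, j) = (\<Sum>l<k. L $$ (i, l) * B $$ (l, j))"
      using i j by (simp add: L_def B scalar_prod_def lessThan_atLeast0)
    also have "\<dots> = (\<Sum>l<k. (if l = i then A $$ (r l, c j) else 0)
        - of_bool (r i < nP \<and> r l = nP + r i) * A $$ (r l, c j))"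
      using i j by (intro sum.cong) (auto simp: L_def B)
    also have "\<dots> = A $$ (r i, c j) - (\<Sum>l<k. of_bool (r i < nP \<and> r l = nP + r i) * A $$ (r l, c j))"
      using i by (simp add: sum_subtractf)
    also have "(\<Sum>l<k. of_bool (r i < nP \<and> r l = nP + r i) * A $$ (r l, c j))
        = of_bool (r i < nP \<and> nP + r i \<in> I \<and> r i = post (c j))"
    proof (cases "r i < nP \<and> nP + r i \<in> I")
      case True
      then obtain l where l: "l < k" "r l = nP + r i" using surj by blast
      have "(\<Sum>m<k. of_bool (r i < nP \<and> r m = nP + r i) * A $$ (r m, c j))
          = (\<Sum>m<k. if m = l then A $$ (r l, c j) else 0)"
        using l True inj by (intro sum.cong) (auto simp: inj_on_def)
      also have "\<dots> = A $$ (nP + r i, c j)" using l by simp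
      finally show ?thesis using True entry[of "nP + r i" "c j"] c_less[OF j] by simp
    next
      case False
      then have "(\<Sum>m<k. of_bool (r i < nP \<and> r m = nP + r i) * A $$ (r m, c j)) = (\<Sum>m<k. 0)"
        using rI by (intro sum.cong) force+
      then show ?thesis using False by auto
    qed
    finally show ?thesis
      using entry[OF r_less[OF i] c_less[OF j]] pre[OF c_less[OF j]] post[OF c_less[OF j]] rI[OF i]
      by (auto simp: h_def)
  qed
  have "L * B = mat k k (\<lambda>(i, j). of_bool (r i = h j) - of_bool (r i = pre (c j)))"
    by (rule eq_matI) (simp_all add: LB dim_L dim_B del: index_mult_mat(1))
  moreover have "det (L * B) = det B"
    using det_mult[of L k B] \<open>det L = 1\<close> by (simp add: L_def B)
  ultimately show "det (submatrix A I J) \<in> {-1, 0, 1}"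
    using det_arc_matrix[OF inj, of h "\<lambda>j. pre (c j)"] by (simp add: B_def)
qed

section \<open>Circulations and rounding of flows\<close>

text \<open>The node-arc incidence matrix, signed so that summing it against a flow gives the net
  inflow at \<open>v\<close>.\<close>

definition arc_coeff :: "('e \<Rightarrow> 'v) \<Rightarrow> ('e \<Rightarrow> 'v) \<Rightarrow> 'v \<Rightarrow> 'e \<Rightarrow> real" where
  "arc_coeff tail head v e = of_bool (head e = v) - of_bool (tail e = v)"

text \<open>The degree bound gives at most as many touched nodes as arcs, so the conservation laws,
  padded by zero rows, form a square system; its rows sum to zero, hence it is singular.\<close>
lemma circulation_exists:
  fixes tail head :: "'e \<Rightarrow> 'v"
  assumes "finite F" "F \<noteq> {}"
    and no_loop: "\<And>e. e \<in> F \<Longrightarrow> tail e \<noteq> head e"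
    and deg: "\<And>v. v \<in> tail ` F \<union> head ` F \<Longrightarrow> 2 \<le> card {e \<in> F. tail e = v \<or> head e = v}"
  shows "\<exists>d. (\<exists>e\<in>F. d e \<noteq> 0) \<and> (\<forall>v. (\<Sum>e\<in>F. arc_coeff tail head v e * d e) = 0)"
proof -
  define N where "N = tail ` F \<union> head ` F"
  define n where "n = card F"
  define m where "m = card N"
  have finN: "finite N" using assms(1) by (simp add: N_def)
  have "n > 0" using assms(1,2) by (simp add: n_def card_gt_0_iff)
  \<comment> \<open>Double counting of incidences: each node has at least two arcs, each arc exactly
    two ends.\<close>
  have "2 * m = (\<Sum>v\<in>N. 2)" by (simp add: m_def)
  also have "\<dots> \<le> (\<Sum>v\<in>N. card {e \<in> F. tail e = v \<or> head e = v})"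
    by (intro sum_mono deg) (simp add: N_def)
  also have "\<dots> = 2 * card F"
  proof (intro sum_multicount[OF finN \<open>finite F\<close>] ballI)
    fix e assume "e \<in> F"
    then have "{v \<in> N. tail e = v \<or> head e = v} = {tail e, head e}" by (auto simp: N_def)
    then show "card {v \<in> N. tail e = v \<or> head e = v} = 2" using no_loop[OF \<open>e \<in> F\<close>] by simp
  qed
  finally have "m \<le> n" by (simp add: n_def)
  obtain w where w: "bij_betw w {..<m} N"
    using ex_bij_betw_nat_finite[OF finN] by (auto simp: m_def lessThan_atLeast0)
  obtain f where f: "bij_betw f {..<n} F"
    using ex_bij_betw_nat_finite[OF \<open>finite F\<close>] by (auto simp: n_def lessThan_atLeast0)
  define A where
    "A = mat n n (\<lambda>(i, j). if i < m then arc_coeff tail head (w i) (f j) else 0)"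
  have A: "A \<in> carrier_mat n n" by (simp add: A_def)
  have "det A = 0"
  proof (rule det_eq_0_if_column_sums_0[OF A \<open>n > 0\<close>])
    fix j assume j: "j < n"
    then have fj: "f j \<in> F" using f by (auto simp: bij_betw_def)
    have "(\<Sum>i<n. A $$ (i, j)) = (\<Sum>i<m. A $$ (i, j))"
      using \<open>m \<le> n\<close> j by (intro sum.mono_neutral_right) (auto simp: A_def)
    also have "\<dots> = (\<Sum>i<m. arc_coeff tail head (w i) (f j))"
      using \<open>m \<le> n\<close> j by (intro sum.cong) (auto simp: A_def)
    also have "\<dots> = (\<Sum>v\<in>N. arc_coeff tail head v (f j))"
      using sum.reindex_bij_betw[OF w] by fast
    \<comment> \<open>Both ends of the arc lie in \<open>N\<close>, so its +1 and its -1 are both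
      counted.\<close>
    also have "\<dots> = 0"
      using fj finN by (auto simp: arc_coeff_def sum_subtractf of_bool_def N_def)
    finally show "(\<Sum>i<n. A $$ (i, j)) = 0" .
  qed
  then obtain u where u: "u \<in> carrier_vec n" "u \<noteq> 0\<^sub>v n" "A *\<^sub>v u = 0\<^sub>v n"
    using det_0_iff_vec_prod_zero_field[OF A] by blast
  \<comment> \<open>The kernel vector, read as a function on arcs through the enumeration
    \<open>f\<close> of \<open>F\<close>.\<close>
  define d where "d e = u $ (the_inv_into {..<n} f e)" for e
  have df: "d (f j) = u $ j" if "j < n" for j
    using that f by (simp add: d_def bij_betw_def the_inv_into_f_f)
  have "\<exists>j<n. u $ j \<noteq> 0"
    using u(1,2) by (metis carrier_vecD eq_vecI index_zero_vec)
  then have "\<exists>e\<in>F. d e \<noteq> 0"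
    using df f by (metis bij_betw_apply lessThan_iff)
  moreover have "(\<Sum>e\<in>F. arc_coeff tail head v e * d e) = 0" for v
  proof (cases "v \<in> N")
    case True
    then obtain i where i: "i < m" "w i = v" using w by (auto simp: bij_betw_def)
    have "(\<Sum>e\<in>F. arc_coeff tail head v e * d e) = (\<Sum>j<n. arc_coeff tail head v (f j) * d (f j))"
      using sum.reindex_bij_betw[OF f, of "\<lambda>e. arc_coeff tail head v e * d e"] by simp
    also have "\<dots> = (\<Sum>j<n. A $$ (i, j) * u $ j)"
      using i \<open>m \<le> n\<close> df by (intro sum.cong) (auto simp: A_def)
    also have "\<dots> = (A *\<^sub>v u) $ i"
      using i \<open>m \<le> n\<close> u(1) A by (simp add: scalar_prod_def lessThan_atLeast0)
    finally show ?thesis using u(3) i \<open>m \<le> n\<close> by simp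
  next
    case False
    then show ?thesis by (intro sum.neutral) (auto simp: arc_coeff_def N_def)
  qed
  ultimately show ?thesis by blast
qed

text \<open>If \<open>e\<close> were the only fractional arc at \<open>v\<close>, all other terms of
  the divergence would be integers. Then so would its own term, which is \<open>f e\<close> or
  \<open>- f e\<close> because \<open>e\<close> is not a loop.\<close>

lemma fractional_degree_ge_2:
  fixes tail head :: "'e \<Rightarrow> 'v"
  assumes "finite E"
    and no_loop: "\<And>e. e \<in> E \<Longrightarrow> tail e \<noteq> head e"
    and div: "(\<Sum>e\<in>E. arc_coeff tail head v e * f e) \<in> \<int>"
    and v: "v \<in> tail ` {e \<in> E. f e \<notin> \<int>} \<union> head ` {e \<in> E. f e \<notin> \<int>}"
  shows "2 \<le> card {e \<in> {e \<in> E. f e \<notin> \<int>}. tail e = v \<or> head e = v}"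
proof -
  obtain e where e: "e \<in> E" "f e \<notin> \<int>" "tail e = v \<or> head e = v"
    using v by auto
  have "\<exists>e'\<in>E. e' \<noteq> e \<and> f e' \<notin> \<int> \<and> (tail e' = v \<or> head e' = v)"
  proof (rule ccontr)
    assume "\<not> ?thesis"
    then have "(\<Sum>e'\<in>E - {e}. arc_coeff tail head v e' * f e') \<in> \<int>"
      by (intro Ints_sum) (auto simp: arc_coeff_def of_bool_def)
    with div have "arc_coeff tail head v e * f e \<in> \<int>"
      using e(1) \<open>finite E\<close> by (simp add: sum.remove[of E e])
    moreover have "arc_coeff tail head v e * f e \<in> {f e, - f e}"
      using e no_loop[OF e(1)] by (auto simp: arc_coeff_def)
    ultimately show False using e(2) by auto
  qed
  then obtain e' where "{e, e'} \<subseteq> {e \<in> {e \<in> E. f e \<notin> \<int>}. tail e = v \<or> head e = v}" "e' \<noteq> e"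
    using e by auto
  then show ?thesis
    using card_mono[of "{e \<in> {e \<in> E. f e \<notin> \<int>}. tail e = v \<or> head e = v}" "{e, e'}"] \<open>finite E\<close>
    by simp
qed

text \<open>Induction on the number of fractional arcs. Bounding the result by floor and ceiling
  makes it respect every integral lower or upper bound that \<open>f\<close> satisfies, so no
  capacities need to be carried along.\<close>

lemma flow_rounding:
  fixes tail head :: "'e \<Rightarrow> 'v" and f c :: "'e \<Rightarrow> real"
  assumes "finite E"
    and no_loop: "\<And>e. e \<in> E \<Longrightarrow> tail e \<noteq> head e"
    and "\<And>v. (\<Sum>e\<in>E. arc_coeff tail head v e * f e) \<in> \<int>"
  shows "\<exists>g. (\<forall>e\<in>E. g e \<in> \<int> \<and> of_int \<lfloor>f e\<rfloor> \<le> g e \<and> g e \<le> of_int \<lceil>f e\<rceil>)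
    \<and> (\<forall>v. (\<Sum>e\<in>E. arc_coeff tail head v e * g e) = (\<Sum>e\<in>E. arc_coeff tail head v e * f e))
    \<and> (\<Sum>e\<in>E. c e * g e) \<le> (\<Sum>e\<in>E. c e * f e)"
  using assms(3)
proof (induction "card {e \<in> E. f e \<notin> \<int>}" arbitrary: f rule: less_induct)
  case less
  define F where "F = {e \<in> E. f e \<notin> \<int>}"
  have finF: "finite F" using \<open>finite E\<close> by (simp add: F_def)
  show ?case
  proof (cases "F = {}")
    case True
    then have "\<forall>e\<in>E. f e \<in> \<int>" by (auto simp: F_def)
    then show ?thesis by (intro exI[of _ f]) (auto elim!: Ints_cases)
  next
    case False
    obtain d0 where d0: "\<exists>e\<in>F. d0 e \<noteq> 0"
        "\<And>v. (\<Sum>e\<in>F. arc_coeff tail head v e * d0 e) = 0"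
      using circulation_exists[OF finF False, of tail head] no_loop
        fractional_degree_ge_2[OF \<open>finite E\<close> no_loop less.prems] unfolding F_def by auto
    \<comment> \<open>A circulation may be reversed; the sign picks the direction of nonpositive
      cost.\<close>
    define sg :: real where "sg = (if (\<Sum>e\<in>F. c e * d0 e) \<le> 0 then 1 else -1)"
    define d where "d e = (if e \<in> F then sg * d0 e else 0)" for e
    have sumd: "(\<Sum>e\<in>E. x e * d e) = sg * (\<Sum>e\<in>F. x e * d0 e)" for x :: "'e \<Rightarrow> real"
    proof -
      have "(\<Sum>e\<in>E. x e * d e) = (\<Sum>e\<in>F. x e * d e)"
        using \<open>finite E\<close> by (intro sum.mono_neutral_right) (auto simp: F_def d_def)
      then show ?thesis by (simp add: d_def sum_distrib_left algebra_simps)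
    qed
    have circ: "(\<Sum>e\<in>E. arc_coeff tail head v e * d e) = 0" for v
      by (simp add: sumd d0)
    have cost: "(\<Sum>e\<in>E. c e * d e) \<le> 0"
      by (simp add: sumd sg_def)
    define D where "D = {e \<in> F. d e \<noteq> 0}"
    have D: "finite D" "D \<noteq> {}"
      using finF d0(1) by (auto simp: D_def d_def sg_def)
    \<comment> \<open>The step length at which arc \<open>e\<close> meets the next integer in its
      direction. It is nonnegative in every case: for negative \<open>d e\<close> numerator and
      denominator are both nonpositive, and division by zero gives 0.\<close>
    define lim where
      "lim e = (if d e > 0 then (of_int \<lceil>f e\<rceil> - f e) / d e else (of_int \<lfloor>f e\<rfloor> - f e) / d e)" for e
    \<comment> \<open>The shortest step: \<open>e0\<close> becomes integral while no other arc
      passes its own bound.\<close>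
    obtain e0 where e0: "e0 \<in> D" and e0_min: "\<And>e. e \<in> D \<Longrightarrow> lim e0 \<le> lim e"
      using ex_min_if_finite[of "lim ` D"] D by (auto simp: not_less) 
    define g where "g e = f e + lim e0 * d e" for e
    have "0 \<le> lim e0"
      by (auto simp: lim_def divide_simps)
    have fl: "of_int \<lfloor>f e\<rfloor> \<le> g e \<and> g e \<le> of_int \<lceil>f e\<rceil>" if "e \<in> E" for e
    proof (cases "e \<in> D")
      case True
      show ?thesis
      proof (cases "d e > 0")
        case pos: True
        have "lim e0 * d e \<le> lim e * d e"
          using e0_min[OF True] pos by (intro mult_right_mono) auto
        moreover have "0 \<le> lim e0 * d e" using pos \<open>0 \<le> lim e0\<close> by simp
        moreover have "lim e * d e = of_int \<lceil>f e\<rceil> - f e" using pos by (simp add: lim_def)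
        ultimately show ?thesis unfolding g_def by linarith
      next
        case False
        then have neg: "d e < 0" using True by (auto simp: D_def)
        have "lim e0 * d e \<ge> lim e * d e"
          using e0_min[OF True] neg by (intro mult_right_mono_neg) auto
        moreover have "lim e0 * d e \<le> 0" using neg \<open>0 \<le> lim e0\<close> by (simp add: mult_nonneg_nonpos)
        moreover have "lim e * d e = of_int \<lfloor>f e\<rfloor> - f e" using neg by (simp add: lim_def)
        ultimately show ?thesis unfolding g_def by linarith
      qed
    next
      case False
      then have "d e = 0" by (auto simp: D_def d_def)
      then show ?thesis by (simp add: g_def)
    qed
    have div: "(\<Sum>e\<in>E. arc_coeff tail head v e * g e) = (\<Sum>e\<in>E. arc_coeff tail head v e * f e)" for v
    proof -
      have "(\<Sum>e\<in>E. arc_coeff tail head v e * g e) = (\<Sum>e\<in>E. arc_coeff tail head v e * f e)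
          + lim e0 * (\<Sum>e\<in>E. arc_coeff tail head v e * d e)"
        by (simp add: g_def sum.distrib sum_distrib_left algebra_simps)
      then show ?thesis by (simp add: circ)
    qed
    have "(\<Sum>e\<in>E. c e * g e) = (\<Sum>e\<in>E. c e * f e) + lim e0 * (\<Sum>e\<in>E. c e * d e)"
      by (simp add: g_def sum.distrib sum_distrib_left algebra_simps)
    then have costg: "(\<Sum>e\<in>E. c e * g e) \<le> (\<Sum>e\<in>E. c e * f e)"
      using cost \<open>0 \<le> lim e0\<close> by (simp add: mult_nonneg_nonpos)
    have "g e0 \<in> \<int>"
      using e0 by (auto simp: g_def lim_def D_def)
    moreover have "g e = f e" if "f e \<in> \<int>" for e
      using that by (simp add: g_def d_def F_def)
    ultimately have "{e \<in> E. g e \<notin> \<int>} \<subset> F"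
      using e0 by (auto simp: F_def D_def)
    then have "card {e \<in> E. g e \<notin> \<int>} < card {e \<in> E. f e \<notin> \<int>}"
      using finF unfolding F_def by (rule psubset_card_mono[rotated])
    from less.hyps[OF this] less.prems obtain h where
      h: "\<forall>e\<in>E. h e \<in> \<int> \<and> of_int \<lfloor>g e\<rfloor> \<le> h e \<and> h e \<le> of_int \<lceil>g e\<rceil>"
        "\<forall>v. (\<Sum>e\<in>E. arc_coeff tail head v e * h e) = (\<Sum>e\<in>E. arc_coeff tail head v e * g e)"
        "(\<Sum>e\<in>E. c e * h e) \<le> (\<Sum>e\<in>E. c e * g e)"
      unfolding div by blast
    \<comment> \<open>The integers enclosing \<open>f e\<close> also enclose \<open>g e\<close>,
      hence its floor and ceiling, and therefore \<open>h e\<close>.\<close>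
    have "of_int \<lfloor>f e\<rfloor> \<le> h e \<and> h e \<le> of_int \<lceil>f e\<rceil>" if "e \<in> E" for e
    proof -
      have "\<lfloor>f e\<rfloor> \<le> \<lfloor>g e\<rfloor>" "\<lceil>g e\<rceil> \<le> \<lceil>f e\<rceil>"
        using fl[OF that] by (simp_all add: le_floor_iff ceiling_le_iff)
      then show ?thesis using h(1) that
        by (meson of_int_le_iff order_trans)
    qed
    then show ?thesis using h div costg by (intro exI[of _ h]) auto
  qed
qed

section \<open>The linear program as a flow problem\<close>

text \<open>Every column is a unit vector. This turns \<open>Pre\<close> and \<open>Post\<close>
  into functions sending a transition to its input and output place.\<close>

lemma zero_one_eq_of_bool:
  assumes "A \<in> carrier_mat m n" "zero_one_mat A" and "\<forall>j<n. \<exists>!i. i < m \<and> A $$ (i, j) = 1"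
  obtains f where "\<And>j. j < n \<Longrightarrow> f j < m" "A = mat m n (\<lambda>(i, j). of_bool (i = f j))"
proof -
  define f where "f j = (THE i. i < m \<and> A $$ (i, j) = 1)" for j
  have f: "f j < m \<and> A $$ (f j, j) = 1" if "j < n" for j
    using theI'[of "\<lambda>i. i < m \<and> A $$ (i, j) = 1"] assms(3) that unfolding f_def by blast
  have entry: "A $$ (i, j) = of_bool (i = f j)" if "i < m" "j < n" for i j
  proof (cases "i = f j")
    case True
    then show ?thesis using f[OF that(2)] by simp
  next
    case False
    then have "A $$ (i, j) \<noteq> 1" using f assms(3) that by blast
    moreover have "A $$ (i, j) \<in> {0, 1}"
      using assms(1,2) that by (auto simp: zero_one_mat_def)
    ultimately show ?thesis using False by auto
  qed
  have "A = mat m n (\<lambda>(i, j). of_bool (i = f j))"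
    using assms(1) entry by (intro eq_matI) auto
  then show thesis using that f by blast
qed

lemma lp_feasible_iff:
  assumes Pre: "Pre = mat nP nT (\<lambda>(p, t). of_bool (p = pre t))"
    and Post: "Post = mat nP nT (\<lambda>(p, t). of_bool (p = post t))"
    and m0: "m0 \<in> carrier_vec nP" and mf: "mf \<in> carrier_vec nP"
  shows "lp_feasible Pre Post m0 mf s \<sigma> \<longleftrightarrow> \<sigma> \<in> carrier_vec nT \<and>
    (\<forall>p<nP. (\<Sum>t<nT. of_bool (p = post t) * \<sigma> $ t) - (\<Sum>t<nT. of_bool (p = pre t) * \<sigma> $ t)
      = mf $ p - real (m0 $ p)) \<and>
    (\<forall>p<nP. (\<Sum>t<nT. of_bool (p = post t) * \<sigma> $ t) + real (m0 $ p) \<le> of_int s) \<and>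
    (\<forall>t<nT. 0 \<le> \<sigma> $ t)"
proof (cases "\<sigma> \<in> carrier_vec nT")
  case True
  have C: "incidence_matrix Pre Post *\<^sub>v \<sigma> = vec nP (\<lambda>p. (\<Sum>t<nT. of_bool (p = post t) * \<sigma> $ t)
      - (\<Sum>t<nT. of_bool (p = pre t) * \<sigma> $ t))"
    using True by (intro eq_vecI)
      (auto simp: incidence_matrix_def Pre Post scalar_prod_def lessThan_atLeast0
        left_diff_distrib sum_subtractf)
  have P: "Post *\<^sub>v \<sigma> = vec nP (\<lambda>p. \<Sum>t<nT. of_bool (p = post t) * \<sigma> $ t)"
    using True by (intro eq_vecI) (auto simp: Post scalar_prod_def lessThan_atLeast0)
  show ?thesis
    unfolding lp_feasible_def C P
    using True m0 mf by (auto simp: vec_eq_iff less_eq_vec_def ones_vec_def Post)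
qed (simp add: lp_feasible_def Post)

text \<open>\<open>flow_rounding\<close> is applied to the network of split places. The arc through
  a place carries its inflow, which turns the bound on \<open>Post\<close> into a capacity of a
  single arc.\<close>

lemma lp_integral_rounding:
  fixes pre post :: "nat \<Rightarrow> nat"
  assumes Pre: "Pre = mat nP nT (\<lambda>(p, t). of_bool (p = pre t))"
    and Post: "Post = mat nP nT (\<lambda>(p, t). of_bool (p = post t))"
    and pre: "\<And>t. t < nT \<Longrightarrow> pre t < nP" and post: "\<And>t. t < nT \<Longrightarrow> post t < nP"
    and m0: "m0 \<in> carrier_vec nP"
    and mf: "mf \<in> carrier_vec nP" "\<And>p. p < nP \<Longrightarrow> mf $ p \<in> \<int>"
    and feas: "lp_feasible Pre Post m0 mf s \<sigma>"
  obtains \<tau> where "lp_feasible Pre Post m0 mf s \<tau>" "\<And>t. t < nT \<Longrightarrow> \<tau> $ t \<in> \<int>"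
    "(\<Sum>t<nT. \<tau> $ t) \<le> (\<Sum>t<nT. \<sigma> $ t)"
proof -
  note iff = lp_feasible_iff[OF Pre Post m0 mf(1)]
  \<comment> \<open>\<open>(p, False)\<close> is the entry node of \<open>p\<close> and
    \<open>(p, True)\<close> its exit node. \<open>Inl t\<close> leads from the exit of
    \<open>pre t\<close> to the entry of \<open>post t\<close>, and \<open>Inr p\<close> from the
    entry to the exit of \<open>p\<close>. Even a transition with \<open>pre t = post t\<close> is
    thus no loop.\<close>
  define E where "E = {..<nT} <+> {..<nP}"
  define tail where "tail = case_sum (\<lambda>t. (pre t, True)) (\<lambda>p. (p, False))"
  define head where "head = case_sum (\<lambda>t. (post t, False)) (\<lambda>p. (p, True))"
  define inflow where "inflow x p = (\<Sum>t<nT. of_bool (p = post t) * x t)" for x :: "nat \<Rightarrow> real" and p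
  define outflow where "outflow x p = (\<Sum>t<nT. of_bool (p = pre t) * x t)" for x :: "nat \<Rightarrow> real" and p
  define f where "f = case_sum (($) \<sigma>) (inflow (($) \<sigma>))"
  define c :: "nat + nat \<Rightarrow> real" where "c = case_sum (\<lambda>_. 1) (\<lambda>_. 0)"
  have sumE: "(\<Sum>e\<in>E. F e) = (\<Sum>t<nT. F (Inl t)) + (\<Sum>p<nP. F (Inr p))"
    for F :: "nat + nat \<Rightarrow> real"
    by (simp add: E_def sum.Plus)
  have div_in: "(\<Sum>e\<in>E. arc_coeff tail head (p, False) e * x e)
      = inflow (x \<circ> Inl) p - (if p < nP then x (Inr p) else 0)" for x p
  proof -
    have "(\<Sum>t<nT. arc_coeff tail head (p, False) (Inl t) * x (Inl t)) = inflow (x \<circ> Inl) p"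
      unfolding inflow_def
      by (intro sum.cong) (auto simp: arc_coeff_def tail_def head_def)
    moreover have "(\<Sum>q<nP. arc_coeff tail head (p, False) (Inr q) * x (Inr q))
        = (\<Sum>q<nP. if q = p then - x (Inr p) else 0)"
      by (intro sum.cong) (auto simp: arc_coeff_def tail_def head_def)
    ultimately show ?thesis by (simp add: sumE)
  qed
  have div_out: "(\<Sum>e\<in>E. arc_coeff tail head (p, True) e * x e)
      = (if p < nP then x (Inr p) else 0) - outflow (x \<circ> Inl) p" for x p
  proof -
    have "(\<Sum>t<nT. arc_coeff tail head (p, True) (Inl t) * x (Inl t)) = - outflow (x \<circ> Inl) p"
      unfolding outflow_def sum_negf[symmetric]
      by (intro sum.cong) (auto simp: arc_coeff_def tail_def head_def)
    moreover have "(\<Sum>q<nP. arc_coeff tail head (p, True) (Inr q) * x (Inr q))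
        = (\<Sum>q<nP. if q = p then x (Inr p) else 0)"
      by (intro sum.cong) (auto simp: arc_coeff_def tail_def head_def)
    ultimately show ?thesis by (simp add: sumE)
  qed
  have f_Inl: "f \<circ> Inl = ($) \<sigma>" and f_Inr: "f (Inr p) = inflow (($) \<sigma>) p" for p
    by (auto simp: f_def)
  have outside: "inflow x p = 0" "outflow x p = 0" if "\<not> p < nP" for x p
    using that pre post unfolding inflow_def outflow_def by (auto intro!: sum.neutral)
  have balance: "inflow (($) \<sigma>) p - outflow (($) \<sigma>) p = mf $ p - real (m0 $ p)" if "p < nP" for p
    using feas that unfolding iff inflow_def outflow_def by blast
  \<comment> \<open>The divergence is 0 at entry nodes and \<open>mf $ p - real (m0 $ p)\<close> at
    exit nodes. Pairs whose first component is not a place meet no arc.\<close>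
  have integral: "(\<Sum>e\<in>E. arc_coeff tail head v e * f e) \<in> \<int>" for v
  proof (cases v)
    case (Pair p b)
    then show ?thesis
      using balance[of p] outside[of p] mf(2)[of p]
      by (cases b) (auto simp: div_in div_out f_Inl f_Inr)
  qed
  have "finite E" by (simp add: E_def)
  have Inl_E: "Inl t \<in> E" if "t < nT" for t
    using that by (auto simp: E_def)
  have Inr_E: "Inr p \<in> E" if "p < nP" for p
    using that by (auto simp: E_def)
  have no_loop: "tail e \<noteq> head e" for e
    by (cases e) (auto simp: tail_def head_def)
  obtain g where g: "\<And>e. e \<in> E \<Longrightarrow> g e \<in> \<int> \<and> of_int \<lfloor>f e\<rfloor> \<le> g e \<and> g e \<le> of_int \<lceil>f e\<rceil>"
    and g_div: "\<And>v. (\<Sum>e\<in>E. arc_coeff tail head v e * g e) = (\<Sum>e\<in>E. arc_coeff tail head v e * f e)"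
    and g_cost: "(\<Sum>e\<in>E. c e * g e) \<le> (\<Sum>e\<in>E. c e * f e)"
    using flow_rounding[OF \<open>finite E\<close> no_loop integral, of c] by blast
  define \<tau> where "\<tau> = vec nT (g \<circ> Inl)"
  have tau: "inflow (($) \<tau>) p = inflow (g \<circ> Inl) p" "outflow (($) \<tau>) p = outflow (g \<circ> Inl) p" for p
    by (simp_all add: inflow_def outflow_def \<tau>_def)
  \<comment> \<open>Zero divergence at the entry node persists, so the rounded place arc again
    carries the inflow.\<close>
  have g_Inr: "g (Inr p) = inflow (($) \<tau>) p" if "p < nP" for p
    using g_div[of "(p, False)"] that by (simp add: div_in f_Inl f_Inr tau)
  show thesis
  proof (rule that)
    show "\<tau> $ t \<in> \<int>" if "t < nT" for t
      using g[OF Inl_E] that by (simp add: \<tau>_def)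
    show "(\<Sum>t<nT. \<tau> $ t) \<le> (\<Sum>t<nT. \<sigma> $ t)"
      using g_cost by (simp add: sumE c_def \<tau>_def f_def)
    have "inflow (($) \<tau>) p - outflow (($) \<tau>) p = mf $ p - real (m0 $ p)" if "p < nP" for p
      using g_div[of "(p, True)"] that balance[OF that]
      by (simp add: div_out f_Inl f_Inr g_Inr flip: tau)
    moreover have "inflow (($) \<tau>) p + real (m0 $ p) \<le> of_int s" if "p < nP" for p
    proof -
      have "inflow (($) \<sigma>) p + real (m0 $ p) \<le> of_int s"
        using feas that unfolding iff inflow_def by blast
      \<comment> \<open>The capacity is an integer, hence it also bounds the ceiling of the
        flow.\<close>
      then have "f (Inr p) \<le> of_int (s - int (m0 $ p))"
        by (simp add: f_Inr)
      then have "\<lceil>f (Inr p)\<rceil> \<le> s - int (m0 $ p)"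
        by (simp only: ceiling_le_iff)
      moreover have "g (Inr p) \<le> of_int \<lceil>f (Inr p)\<rceil>"
        using g[OF Inr_E] that by blast
      ultimately show ?thesis
        unfolding g_Inr[OF that] by linarith
    qed
    moreover have "0 \<le> \<tau> $ t" if "t < nT" for t
    proof -
      have "0 \<le> f (Inl t)" using feas that by (simp add: iff f_def)
      then have "0 \<le> real_of_int \<lfloor>f (Inl t)\<rfloor>" by simp
      also have "\<dots> \<le> g (Inl t)" using g[OF Inl_E[OF that]] by blast
      finally show ?thesis using that by (simp add: \<tau>_def)
    qed
    ultimately show "lp_feasible Pre Post m0 mf s \<tau>"
      unfolding iff inflow_def outflow_def by (simp add: \<tau>_def)
  qed
qed

section \<open>Total unimodularity and existence of an integral optimum\<close>

theorem theorem3: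
  fixes nP nT nR :: nat
    and Pre Post V :: "real mat"
    and m0 :: "nat vec"
    and mf :: "real vec"
    and s :: int
    and M :: real
  assumes "state_machine nP nT Pre Post"
    and "tapf_instance nP nR m0 V"
    and "mf = final_marking V"
    and "s \<ge> 1"
    and "M > 0"
  shows "totally_unimodular (incidence_matrix Pre Post @\<^sub>r Post) \<and>
         ((\<exists>\<sigma>. lp_feasible Pre Post m0 mf s \<sigma>) \<longrightarrow>
          (\<exists>\<sigma>. lp_optimal Pre Post m0 mf M s \<sigma> \<and> (\<forall>t<nT. \<sigma> $ t \<in> \<int>)))"
proof -
  have net: "Pre \<in> carrier_mat nP nT" "Post \<in> carrier_mat nP nT" "zero_one_mat Pre" "zero_one_mat Post"
      "\<forall>t<nT. \<exists>!p. p < nP \<and> Pre $$ (p, t) = 1" "\<forall>t<nT. \<exists>!p. p < nP \<and> Post $$ (p, t) = 1"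
    using assms(1) by (auto simp: state_machine_def petri_net_def)
  obtain pre where pre: "\<And>t. t < nT \<Longrightarrow> pre t < nP"
    and Pre: "Pre = mat nP nT (\<lambda>(p, t). of_bool (p = pre t))"
    using zero_one_eq_of_bool[OF net(1,3,5)] by blast
  obtain post where post: "\<And>t. t < nT \<Longrightarrow> post t < nP"
    and Post: "Post = mat nP nT (\<lambda>(p, t). of_bool (p = post t))"
    using zero_one_eq_of_bool[OF net(2,4,6)] by blast
  have V: "V \<in> carrier_mat nR nP" "zero_one_mat V" and m0: "m0 \<in> carrier_vec nP"
    using assms(2) by (auto simp: tapf_instance_def)
  have mf: "mf \<in> carrier_vec nP"
    using V by (intro carrier_vecI) (simp add: assms(3) final_marking_def)
  have mf_Ints: "mf $ p \<in> \<int>" if "p < nP" for p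
  proof -
    have "V $$ (r, p) \<in> \<int>" if "r < nR" for r
    proof -
      have "V $$ (r, p) \<in> {0, 1}"
        using V \<open>p < nP\<close> that by (auto simp: zero_one_mat_def)
      then show ?thesis by auto
    qed
    then show ?thesis
      using V that by (auto simp: assms(3) final_marking_def ones_vec_def scalar_prod_def intro!: Ints_sum)
  qed
  note rounding = lp_integral_rounding[OF Pre Post pre post m0 mf mf_Ints]
  have feasD: "\<sigma> \<in> carrier_vec nT" "\<forall>t<nT. 0 \<le> \<sigma> $ t" if "lp_feasible Pre Post m0 mf s \<sigma>" for \<sigma>
    using that lp_feasible_iff[OF Pre Post m0 mf] by blast+
  have objective: "lp_objective M s \<sigma> = (\<Sum>t<nT. \<sigma> $ t) + M * of_int s" if "\<sigma> \<in> carrier_vec nT" for \<sigma>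
    using that by (simp add: lp_objective_def ones_vec_def scalar_prod_def lessThan_atLeast0)
  have "\<exists>\<sigma>. lp_optimal Pre Post m0 mf M s \<sigma> \<and> (\<forall>t<nT. \<sigma> $ t \<in> \<int>)"
    if "lp_feasible Pre Post m0 mf s \<rho>" for \<rho>
  proof -
    define Q where "Q \<tau> \<longleftrightarrow> lp_feasible Pre Post m0 mf s \<tau> \<and> (\<forall>t<nT. \<tau> $ t \<in> \<int>)" for \<tau>
    \<comment> \<open>On integral feasible points this is the exact cost up to the constant
      \<open>M * of_int s\<close>. Being a natural number, it attains a minimum by
      well-ordering.\<close>
    define size where "size \<tau> = nat \<lfloor>\<Sum>t<nT. \<tau> $ t\<rfloor>" for \<tau> :: "real vec"
    have size: "real (size \<tau>) = (\<Sum>t<nT. \<tau> $ t)" if "Q \<tau>" for \<tau>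
    proof -
      have "(\<Sum>t<nT. \<tau> $ t) \<in> \<int>" "0 \<le> (\<Sum>t<nT. \<tau> $ t)"
        using that feasD[of \<tau>] by (auto simp: Q_def intro!: Ints_sum sum_nonneg)
      then show ?thesis by (auto simp: size_def elim!: Ints_cases)
    qed
    obtain \<tau>0 where "Q \<tau>0"
      using rounding[OF _ _ _ \<open>lp_feasible Pre Post m0 mf s \<rho>\<close>] unfolding Q_def by blast
    then obtain \<tau> where \<tau>: "Q \<tau>" and \<tau>_min: "\<And>\<tau>'. Q \<tau>' \<Longrightarrow> size \<tau> \<le> size \<tau>'"
      using ex_has_least_nat[of Q \<tau>0 size] by blast
    have "lp_objective M s \<tau> \<le> lp_objective M s \<sigma>" if \<sigma>: "lp_feasible Pre Post m0 mf s \<sigma>" for \<sigma>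
    proof -
      \<comment> \<open>Rounding carries minimality over from integral points to all real feasible
        points.\<close>
      obtain \<tau>' where "Q \<tau>'" "(\<Sum>t<nT. \<tau>' $ t) \<le> (\<Sum>t<nT. \<sigma> $ t)"
        using rounding[OF _ _ _ \<sigma>] unfolding Q_def by blast
      then have "(\<Sum>t<nT. \<tau> $ t) \<le> (\<Sum>t<nT. \<sigma> $ t)"
        using \<tau>_min[of \<tau>'] size[OF \<tau>] size[of \<tau>'] by linarith
      then show ?thesis
        using \<tau> \<sigma> feasD by (simp add: objective Q_def)
    qed
    then show ?thesis
      using \<tau> unfolding lp_optimal_def Q_def by blast
  qed
  then show ?thesis
    using totally_unimodular_incidence_append_post[OF Pre Post pre post] by blast
qed

end
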